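(* Let $c>1$ be a constant, let $n$ be a positive integer, let $s=s(n)\ge 1$ be an integer, and let $p=\frac{c\log n}{sn}$. Let $X$ be a set of $n$ vertices and let $\mathcal G=\{G_1,\dots,G_s\}$ be a family of $s$ graphs on $X$, each sampled independently from $G(n,p)$. If $$s\le \frac{\log n}{\log c-1+\log\log n}-\frac12+\frac{\log\log\log n}{3\log\log n},$$ then asymptotically almost surely (i.e. with probability tending to $1$ as $n\to\infty$) $\mathcal G$ is not rainbow connected.
   Context: $\log$ denotes the natural logarithm. $G(n,p)$ is the Erdős–Rényi random graph: each of the $\binom n2$ pairs is an edge independently with probability $p$. A path $P$ with $E(P)\subseteq\bigcup_{i=1}^s E(G_i)$ is a rainbow path if there is an injection $\phi:E(P)\to[s]$ with $e\in E(G_{\phi(e)})$ for every $e\in E(P)$ (equivalently, coloring edges of $G_i$ with color $i$, the path uses each color at most once). The family $\mathcal G$ is rainbow connected if every pair of distinct vertices of $X$ is joined by a rainbow path. *)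

theory Defs
  imports "HOL-Probability.Probability" "HOL-Probability.Product_PMF"
begin

text \<open>A simple graph on a vertex set \<open>X\<close> is represented by its edge set, a subset of \<open>pairs X\<close>.\<close>

definition pairs :: "'v set \<Rightarrow> 'v set set" where
  "pairs X = {e. e \<subseteq> X \<and> card e = 2}"

text \<open>Note that \<^const>\<open>bernoulli_pmf\<close> truncates its parameter to the interval from 0 to 1.\<close>

definition gnp :: "'v set \<Rightarrow> real \<Rightarrow> 'v set set pmf" where
  "gnp X p = map_pmf (\<lambda>f. {e \<in> pairs X. f e}) (Pi_pmf (pairs X) False (\<lambda>_. bernoulli_pmf p))"

definition gnp_family :: "'v set \<Rightarrow> nat \<Rightarrow> real \<Rightarrow> (nat \<Rightarrow> 'v set set) pmf" where
  "gnp_family X s p = Pi_pmf {1..s} {} (\<lambda>_. gnp X p)"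

text \<open>Paths are given by their sequences of vertices.\<close>

definition path_in :: "'v set \<Rightarrow> 'v list \<Rightarrow> bool" where
  "path_in X vs \<longleftrightarrow> vs \<noteq> [] \<and> distinct vs \<and> set vs \<subseteq> X"

definition path_edges :: "'v list \<Rightarrow> 'v set set" where
  "path_edges vs = {{vs ! i, vs ! Suc i} | i. Suc i < length vs}"

definition rainbow_path :: "'v set \<Rightarrow> nat \<Rightarrow> (nat \<Rightarrow> 'v set set) \<Rightarrow> 'v list \<Rightarrow> bool" where
  "rainbow_path X s G vs \<longleftrightarrow>
     path_in X vs \<and> path_edges vs \<subseteq> (\<Union>i\<in>{1..s}. G i) \<and>
     (\<exists>\<phi>. inj_on \<phi> (path_edges vs) \<and> \<phi> ` path_edges vs \<subseteq> {1..s} \<and>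
          (\<forall>e\<in>path_edges vs. e \<in> G (\<phi> e)))"

definition rainbow_connected :: "'v set \<Rightarrow> nat \<Rightarrow> (nat \<Rightarrow> 'v set set) \<Rightarrow> bool" where
  "rainbow_connected X s G \<longleftrightarrow>
     (\<forall>u\<in>X. \<forall>v\<in>X. u \<noteq> v \<longrightarrow> (\<exists>vs. rainbow_path X s G vs \<and> hd vs = u \<and> last vs = v))"

end

theory Submission
  imports Defs "HOL-Real_Asymp.Real_Asymp"
begin

text \<open>
  First moment method for a single pair of vertices \<open>u\<close>, \<open>v\<close>. There are at most
  \<open>n^(k-1) * s!/(s-k)!\<close> ways to choose a path of length \<open>k\<close> from \<open>u\<close> to \<open>v\<close> together with
  distinct colours for its edges, and each choice is realised with probability at most \<open>p^k\<close>.
  With \<open>p = c L / (s n)\<close> and \<open>L = log n\<close> the sum over \<open>k\<close> is dominated by \<open>k = s\<close>, and Stirling's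
  formula bounds it by a constant times \<open>sqrt s * (c L / e)^s / n\<close>. At the assumed maximal value
  of \<open>s\<close> the logarithm of this is \<open>- (1/2 - 1/3) log log L + O(1)\<close>.
\<close>

section \<open>Analytic estimates for factorials and falling factorials\<close>

text \<open>Induction works because the right-hand side grows from n to n + 1 by at least the factor
  n + 1, which amounts to (n + 1/2) ln(1 + 1/n) >= 1. The order sqrt n matters: the threshold leaves
  no room for a larger power of s.\<close>

lemma fact_le_stirling:
  assumes "n \<ge> 1"
  shows "fact n \<le> sqrt (real n) * real n ^ n * exp (1 - real n)"
  using assms
proof (induction n rule: dec_induct)
  case base
  then show ?case by simp
next
  case (step n)
  define x where "x = real n"
  have x: "x \<ge> 1" using step by (simp add: x_def)
  \<comment> \<open>By convexity, the integral of 1/t over [x, x + 1] is at least the integrand at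
    the midpoint.\<close>
  have "2 / (2 * x + 1) \<le> ln (x + 1) - ln x"
    using ln_inverse_approx_ge[of x "x + 1"] x by (simp add: add_ac)
  then have key: "1 \<le> (x + 1 / 2) * (ln (x + 1) - ln x)"
    using x by (simp add: field_simps)
  have sqrt_pow: "sqrt z * z ^ n = exp (ln z / 2 + x * ln z)" if "z > 0" for z
  proof -
    have "sqrt z = exp (ln z / 2)"
      using that by (simp add: powr_half_sqrt[symmetric] powr_def)
    moreover have "z ^ n = exp (x * ln z)"
      using that by (simp add: x_def exp_of_nat_mult)
    ultimately show ?thesis by (simp add: exp_add)
  qed
  have "sqrt x * x ^ n * exp (1 - x) = exp (ln x / 2 + x * ln x + (1 - x))"
    using x by (simp add: sqrt_pow mult_exp_exp)
  also have "\<dots> \<le> exp (ln (x + 1) / 2 + x * ln (x + 1) + - x)"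
    using key by (simp add: algebra_simps)
  also have "\<dots> = sqrt (x + 1) * (x + 1) ^ n * exp (- x)"
    using x by (simp add: sqrt_pow mult_exp_exp)
  finally have *: "sqrt x * x ^ n * exp (1 - x) \<le> sqrt (x + 1) * (x + 1) ^ n * exp (- x)" .
  have "fact (Suc n) = (x + 1) * fact n" by (simp add: x_def)
  also have "\<dots> \<le> (x + 1) * (sqrt x * x ^ n * exp (1 - x))"
    using step x by (intro mult_left_mono) (auto simp: x_def)
  also have "\<dots> \<le> (x + 1) * (sqrt (x + 1) * (x + 1) ^ n * exp (- x))"
    using * x by (intro mult_left_mono) auto
  finally show ?case by (simp add: x_def algebra_simps)
qed

lemma sum_power_div_fact_le_exp:
  fixes x :: real
  assumes "x \<ge> 0" "finite I"
  shows "(\<Sum>k\<in>I. x ^ k / fact k) \<le> exp x"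
proof -
  have "(\<lambda>k. x ^ k / fact k) sums exp x"
    using exp_converges[of x] by (simp add: divide_inverse mult.commute)
  then show ?thesis
    using sum_le_suminf[of "\<lambda>k. x ^ k / fact k" I] assms by (auto simp: sums_iff)
qed

text \<open>Reversing the index to s - k leaves the term k = s times a partial sum of the
  exponential series at 1/y. For y >= 1 the last term therefore dominates up to a factor e.\<close>

lemma sum_power_falling_fact_le:
  fixes y :: real
  assumes "y > 0"
  shows "(\<Sum>k = 1..s. y ^ k * (fact s / fact (s - k))) \<le> fact s * y ^ s * exp (1 / y)"
proof -
  have "(\<Sum>k = 1..s. y ^ k * (fact s / fact (s - k)))
      = (\<Sum>k = 1..s. fact s * y ^ s * ((1 / y) ^ (s - k) / fact (s - k)))"
    using assms by (intro sum.cong refl) (auto simp: power_one_over power_diff field_simps)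
  also have "\<dots> = fact s * y ^ s * (\<Sum>k = 1..s. (1 / y) ^ (s - k) / fact (s - k))"
    by (simp add: sum_distrib_left)
  also have "(\<Sum>k = 1..s. (1 / y) ^ (s - k) / fact (s - k)) = (\<Sum>j<s. (1 / y) ^ j / fact j)"
    by (rule sum.reindex_bij_witness[of _ "\<lambda>j. s - j" "\<lambda>k. s - k"]) auto
  also have "fact s * y ^ s * (\<Sum>j<s. (1 / y) ^ j / fact j) \<le> fact s * y ^ s * exp (1 / y)"
    using assms by (intro mult_left_mono sum_power_div_fact_le_exp) auto
  finally show ?thesis .
qed

section \<open>Probability that prescribed edges have prescribed colours\<close>

lemma prob_gnp_edge_le:
  assumes "finite X" "p \<ge> 0"
  shows "measure_pmf.prob (gnp X p) {E. e \<in> E} \<le> p"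
proof (cases "e \<in> pairs X")
  case True
  have fin: "finite (pairs X)"
    using assms by (auto simp: pairs_def intro: finite_subset[of _ "Pow X"])
  have "measure_pmf.prob (gnp X p) {E. e \<in> E}
      = measure_pmf.prob (map_pmf (\<lambda>f. f e) (Pi_pmf (pairs X) False (\<lambda>_. bernoulli_pmf p))) {True}"
    using True by (simp add: gnp_def vimage_def)
  also have "\<dots> = pmf (bernoulli_pmf p) True"
    using True fin by (simp add: Pi_pmf_component measure_pmf_single)
  also have "\<dots> \<le> p"
    using assms by (cases "p \<le> 1") (auto simp: bernoulli_pmf.rep_eq)
  finally show ?thesis .
next
  case False
  then show ?thesis
    using assms by (simp add: gnp_def vimage_def)
qed

text \<open>Distinct colours refer to independent graphs, so the probabilities multiply even when
  some of the sets \<open>e i\<close> coincide.\<close>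

lemma prob_gnp_family_le:
  assumes "finite X" "p \<ge> 0" "distinct cs" "set cs \<subseteq> {1..s}"
  shows "measure_pmf.prob (gnp_family X s p) {G. \<forall>i<length cs. e i \<in> G (cs ! i)} \<le> p ^ length cs"
proof -
  define idx where "idx j = (THE i. i < length cs \<and> cs ! i = j)" for j
  have idx: "idx (cs ! i) = i" if "i < length cs" for i
    unfolding idx_def using that assms(3) by (auto simp: nth_eq_iff_index_eq intro!: the_equality)
  \<comment> \<open>The event is written as a box over all s colours, with no constraint at colours
    outside \<open>cs\<close>, so that independence turns it into a product.\<close>
  define B where "B j = (if j \<in> set cs then {E. e (idx j) \<in> E} else UNIV)" for j
  have "(\<forall>i<length cs. e i \<in> G (cs ! i)) \<longleftrightarrow> G \<in> Pi {1..s} B" for G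
  proof -
    have "G \<in> Pi {1..s} B \<longleftrightarrow> (\<forall>j\<in>set cs. e (idx j) \<in> G j)"
      using assms(4) by (auto simp: B_def Pi_iff)
    also have "\<dots> \<longleftrightarrow> (\<forall>i<length cs. e i \<in> G (cs ! i))"
      by (auto simp: all_set_conv_all_nth idx)
    finally show ?thesis by simp
  qed
  then have "{G. \<forall>i<length cs. e i \<in> G (cs ! i)} = Pi {1..s} B"
    by blast
  then have "measure_pmf.prob (gnp_family X s p) {G. \<forall>i<length cs. e i \<in> G (cs ! i)}
      = (\<Prod>j\<in>{1..s}. measure_pmf.prob (gnp X p) (B j))"
    unfolding gnp_family_def by (simp add: measure_Pi_pmf_Pi)
  also have "\<dots> = (\<Prod>j\<in>set cs. measure_pmf.prob (gnp X p) (B j))"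
    using assms(4) by (intro prod.mono_neutral_right) (auto simp: B_def)
  also have "\<dots> \<le> (\<Prod>j\<in>set cs. p)"
    using assms by (intro prod_mono) (auto simp: B_def prob_gnp_edge_le)
  also have "\<dots> = p ^ length cs"
    using assms(3) by (simp add: distinct_card)
  finally show ?thesis .
qed

section \<open>Union bound over coloured walks\<close>

text \<open>The inner vertices \<open>ws\<close> may repeat, so these are walks rather than paths;
  this makes them easy to count and only enlarges the union bound.\<close>

definition coloured_path :: "'v \<Rightarrow> 'v \<Rightarrow> (nat \<Rightarrow> 'v set set) \<Rightarrow> 'v list \<Rightarrow> nat list \<Rightarrow> bool" where
  "coloured_path u v G ws cs \<longleftrightarrow>
     (\<forall>i<length cs. {(u # ws @ [v]) ! i, (u # ws @ [v]) ! Suc i} \<in> G (cs ! i))"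

lemma rainbow_path_imp_coloured_path:
  assumes "rainbow_path X s G vs" "hd vs = u" "last vs = v" "u \<noteq> v"
  obtains ws cs where "set ws \<subseteq> X" "distinct cs" "set cs \<subseteq> {1..s}"
    "length cs = Suc (length ws)" "coloured_path u v G ws cs"
proof -
  have vs: "vs \<noteq> []" "distinct vs" "set vs \<subseteq> X"
    using assms(1) by (auto simp: rainbow_path_def path_in_def)
  obtain \<phi> where \<phi>: "inj_on \<phi> (path_edges vs)" "\<phi> ` path_edges vs \<subseteq> {1..s}"
      "\<forall>e\<in>path_edges vs. e \<in> G (\<phi> e)"
    using assms(1) by (auto simp: rainbow_path_def)
  obtain ys where ys: "vs = u # ys" using vs(1) assms(2) by (cases vs) auto
  have "ys \<noteq> []" using assms(3,4) ys by auto
  then obtain ws where "ys = ws @ [v]"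
    using assms(3) ys by (metis append_butlast_last_id last_ConsR)
  with ys have vs_eq: "vs = u # ws @ [v]" by simp
  then have len: "length vs = Suc (Suc (length ws))" by simp
  define e where "e i = {vs ! i, vs ! Suc i}" for i
  have e_in: "e i \<in> path_edges vs" if "i < Suc (length ws)" for i
    using that unfolding path_edges_def e_def vs_eq by auto
  \<comment> \<open>Since the vertices are distinct, two edges can agree only with the same
    orientation: the reversed match would need i = j + 1 and j = i + 1.\<close>
  have e_inj: "i = j" if "e i = e j" "i < Suc (length ws)" "j < Suc (length ws)" for i j
    using that vs(2) unfolding e_def doubleton_eq_iff
    by (auto simp: nth_eq_iff_index_eq len)
  define cs where "cs = map (\<lambda>i. \<phi> (e i)) [0..<Suc (length ws)]"
  show ?thesis
  proof (rule that)
    show "set ws \<subseteq> X" using vs(3) vs_eq by auto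
    show "distinct cs"
      unfolding cs_def distinct_map using \<phi>(1) e_in e_inj
      by (auto intro!: inj_onI dest!: inj_onD simp del: upt_Suc)
    show "set cs \<subseteq> {1..s}" using \<phi>(2) e_in by (auto simp: cs_def image_subset_iff simp del: upt_Suc)
    show "length cs = Suc (length ws)" by (simp add: cs_def)
    show "coloured_path u v G ws cs"
      unfolding coloured_path_def using \<phi>(3) e_in
      by (auto simp: cs_def e_def vs_eq simp del: upt_Suc)
  qed
qed

text \<open>Connectedness is tested on one fixed pair u, v only. The union bound runs over the
  length k, the k - 1 inner vertices and the ordered list of k distinct colours.\<close>

lemma prob_rainbow_connected_le:
  fixes X :: "'v set"
  assumes "finite X" "card X = n" "n \<ge> 2" "p \<ge> 0"
  shows "measure_pmf.prob (gnp_family X s p) {G. rainbow_connected X s G}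
       \<le> (\<Sum>k = 1..s. real n ^ (k - 1) * (fact s / fact (s - k)) * p ^ k)"
proof -
  obtain u v where uv: "u \<in> X" "v \<in> X" "u \<noteq> v"
    using assms by (metis One_nat_def Suc_1 card_le_Suc0_iff_eq not_less_eq_eq)
  define W where "W k = {ws :: 'v list. set ws \<subseteq> X \<and> length ws = k - 1}" for k :: nat
  define C where "C k = {cs. length cs = k \<and> distinct cs \<and> set cs \<subseteq> {1..s}}" for k :: nat
  define A where "A = (\<lambda>(k :: nat, ws, cs). {G. coloured_path u v G ws cs})"
  define I where "I = Sigma {1..s} (\<lambda>k. W k \<times> C k)"
  have finW: "finite (W k)" and cardW: "card (W k) = n ^ (k - 1)" for k
    using assms unfolding W_def by (auto simp: finite_lists_length_eq card_lists_length_eq)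
  have finC: "finite (C k)" for k
    unfolding C_def by (rule finite_subset[OF _ finite_lists_length_eq[of "{1..s}" k]]) auto
  have cardC: "real (card (C k)) = fact s / fact (s - k)" if "k \<le> s" for k
  proof -
    have "card (C k) = \<Prod>{s - k + 1..s}"
      unfolding C_def using card_lists_distinct_length_eq[of "{1..s}" k] that by simp
    moreover have "fact s = \<Prod>{s - k + 1..s} * fact (s - k)"
    proof -
      have "fact s = \<Prod>{1..s}" by (simp add: fact_prod)
      also have "{1..s} = {1..s - k} \<union> {s - k + 1..s}" using that by auto
      also have "\<Prod>({1..s - k} \<union> {s - k + 1..s}) = \<Prod>{1..s - k} * \<Prod>{s - k + 1..s}"
        by (rule prod.union_disjoint) auto
      finally show ?thesis by (simp add: fact_prod)
    qed
    ultimately have "fact s = card (C k) * fact (s - k)" by simp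
    then have "(fact s :: real) = real (card (C k)) * fact (s - k)"
      by (metis of_nat_fact of_nat_mult)
    then show ?thesis by simp
  qed
  have finI: "finite I" unfolding I_def using finW finC by auto
  have "{G. rainbow_connected X s G} \<subseteq> (\<Union>i\<in>I. A i)"
  proof
    fix G assume "G \<in> {G. rainbow_connected X s G}"
    then obtain vs where "rainbow_path X s G vs" "hd vs = u" "last vs = v"
      using uv by (auto simp: rainbow_connected_def)
    then obtain ws cs where *: "set ws \<subseteq> X" "distinct cs" "set cs \<subseteq> {1..s}"
        "length cs = Suc (length ws)" "coloured_path u v G ws cs"
      using uv(3) by (elim rainbow_path_imp_coloured_path)
    \<comment> \<open>Distinct colours from s available ones cap the path length, which makes the
      index set finite.\<close>
    have "length cs \<le> s"
      using card_mono[OF _ *(3)] *(2) by (simp add: distinct_card)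
    then have "(length cs, ws, cs) \<in> I" using * by (auto simp: I_def W_def C_def)
    moreover have "G \<in> A (length cs, ws, cs)" using * by (simp add: A_def)
    ultimately show "G \<in> (\<Union>i\<in>I. A i)" by blast
  qed
  then have "measure_pmf.prob (gnp_family X s p) {G. rainbow_connected X s G}
      \<le> measure_pmf.prob (gnp_family X s p) (\<Union>i\<in>I. A i)"
    by (intro measure_pmf.finite_measure_mono) auto
  also have "\<dots> \<le> (\<Sum>i\<in>I. measure_pmf.prob (gnp_family X s p) (A i))"
    using finI by (intro measure_pmf.finite_measure_subadditive_finite) auto
  also have "\<dots> \<le> (\<Sum>i\<in>I. p ^ fst i)"
  proof (rule sum_mono)
    fix i assume "i \<in> I"
    then obtain k ws cs where i: "i = (k, ws, cs)" "length cs = k" "distinct cs" "set cs \<subseteq> {1..s}"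
      by (auto simp: I_def C_def)
    then show "measure_pmf.prob (gnp_family X s p) (A i) \<le> p ^ fst i"
      using prob_gnp_family_le[OF assms(1,4) i(3,4)] by (simp add: A_def coloured_path_def)
  qed
  also have "\<dots> = (\<Sum>k = 1..s. \<Sum>x\<in>W k \<times> C k. p ^ k)"
    unfolding I_def using finW finC by (subst sum.Sigma) (auto simp: case_prod_beta)
  also have "\<dots> = (\<Sum>k = 1..s. real n ^ (k - 1) * (fact s / fact (s - k)) * p ^ k)"
    by (intro sum.cong refl) (simp add: cardW cardC card_cartesian_product)
  finally show ?thesis .
qed

section \<open>Evaluating the first moment at the threshold\<close>

text \<open>With y = c L / s one has p = y / n, so n^(k-1) p^k = y^k / n. The assumption s <= c L
  gives y >= 1, hence exp(1/y) <= e; this e and the one from Stirling's bound make up the constant 2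
  in the exponent.\<close>

lemma first_moment_le:
  fixes L c :: real
  assumes "n \<ge> 1" "s \<ge> 1" "c > 0" "L > 0" "real s \<le> c * L"
  defines "p \<equiv> c * L / (real s * real n)"
  shows "(\<Sum>k = 1..s. real n ^ (k - 1) * (fact s / fact (s - k)) * p ^ k)
       \<le> exp (2 + ln (real s) / 2 + real s * (ln c - 1 + ln L)) / real n"
proof -
  define y where "y = c * L / real s"
  have y: "y \<ge> 1" using assms by (simp add: y_def)
  have "(\<Sum>k = 1..s. real n ^ (k - 1) * (fact s / fact (s - k)) * p ^ k)
      = (\<Sum>k = 1..s. y ^ k * (fact s / fact (s - k))) / real n"
    unfolding sum_divide_distrib
  proof (intro sum.cong refl)
    fix k assume "k \<in> {1..s}"
    then obtain j where k: "k = Suc j" by (cases k) auto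
    have "p = y / real n" by (simp add: p_def y_def)
    then show "real n ^ (k - 1) * (fact s / fact (s - k)) * p ^ k
        = y ^ k * (fact s / fact (s - k)) / real n"
      using assms(1) by (simp add: k power_divide)
  qed
  also have "\<dots> \<le> fact s * y ^ s * exp (1 / y) / real n"
    using y by (intro divide_right_mono sum_power_falling_fact_le) auto
  also have "\<dots> \<le> (sqrt (real s) * real s ^ s * exp (1 - real s)) * y ^ s * exp 1 / real n"
    using y fact_le_stirling[OF assms(2)] by (intro divide_right_mono mult_mono) auto
  \<comment> \<open>Here s^s cancels against the denominator of y^s.\<close>
  also have "\<dots> = sqrt (real s) * (c * L) ^ s * exp (2 - real s) / real n"
    using assms(2) by (simp add: y_def power_divide exp_diff mult_exp_exp)
  also have "sqrt (real s) = exp (ln (real s) / 2)"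
    using assms(2) by (simp add: powr_half_sqrt[symmetric] powr_def)
  also have "(c * L) ^ s = exp (real s * (ln c + ln L))"
    using assms by (simp add: exp_of_nat_mult exp_add)
  also have "exp (ln (real s) / 2) * exp (real s * (ln c + ln L)) * exp (2 - real s)
      = exp (2 + ln (real s) / 2 + real s * (ln c - 1 + ln L))"
    by (simp add: mult_exp_exp algebra_simps)
  finally show ?thesis .
qed

theorem theorem1p2:
  fixes c :: real and s :: "nat \<Rightarrow> nat" and X :: "nat \<Rightarrow> 'v set"
  assumes "c > 1"
    and "\<And>n. n \<ge> 1 \<Longrightarrow> s n \<ge> 1"
    and "\<And>n. n \<ge> 1 \<Longrightarrow> finite (X n) \<and> card (X n) = n"
    and "\<forall>\<^sub>F n in sequentially.
           real (s n) \<le> ln (real n) / (ln c - 1 + ln (ln (real n))) - 1 / 2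
                        + ln (ln (ln (real n))) / (3 * ln (ln (real n)))"
  shows "(\<lambda>n. measure_pmf.prob
                (gnp_family (X n) (s n) (c * ln (real n) / (real (s n) * real n)))
                {G. \<not> rainbow_connected (X n) (s n) G}) \<longlonglongrightarrow> 1"
proof -
  define M where "M n = gnp_family (X n) (s n) (c * ln (real n) / (real (s n) * real n))" for n
  \<comment> \<open>\<open>D n\<close> is both the denominator in the threshold and the coefficient
    of s in the exponent of \<open>first_moment_le\<close>.\<close>
  define D where "D n = ln c - 1 + ln (ln (real n))" for n :: nat
  define t where "t n = ln (ln (ln (real n))) / (3 * ln (ln (real n)))" for n :: nat
  \<comment> \<open>This is the first moment bound after inserting ln s <= ln(L / D) and s D <= L +
    (t - 1/2) D, where L = ln n; the term L cancels against the factor 1/n.\<close>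
  define b where "b n = exp (2 + (ln (ln (real n)) - ln (D n)) / 2 + (t n - 1 / 2) * D n)" for n
  have D_pos: "\<forall>\<^sub>F n in sequentially. D n > 0"
    unfolding D_def using assms(1) by real_asymp
  \<comment> \<open>This gives the cruder bound s <= L / D, which suffices for the factor sqrt s and
    for the requirement s <= c L.\<close>
  have t_le: "\<forall>\<^sub>F n in sequentially. t n \<le> 1 / 2"
    unfolding t_def by real_asymp
  have L_le: "\<forall>\<^sub>F n in sequentially. ln (real n) / D n \<le> c * ln (real n)"
    unfolding D_def using assms(1) by real_asymp
  \<comment> \<open>The terms (ln ln n) / 2 and - D / 2 cancel up to a constant; what decides is -
    (ln D) / 2 against t D, which is asymptotically (ln ln ln n) / 3.\<close>
  have b_lim: "b \<longlonglongrightarrow> 0"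
    unfolding b_def D_def t_def using assms(1) by real_asymp
  have bound: "\<forall>\<^sub>F n in sequentially. measure_pmf.prob (M n) {G. rainbow_connected (X n) (s n) G} \<le> b n"
    using assms(4) D_pos t_le L_le eventually_ge_at_top[of 2]
  proof eventually_elim
    case (elim n)
    define L where "L = ln (real n)"
    have L: "L > 0" using elim by (simp add: L_def)
    have s1: "s n \<ge> 1" using assms(2) elim by simp
    have s_le: "real (s n) \<le> L / D n - 1 / 2 + t n"
      using elim(1) by (simp add: L_def D_def t_def)
    then have s_le': "real (s n) \<le> L / D n" using elim(3) by simp
    have "measure_pmf.prob (M n) {G. rainbow_connected (X n) (s n) G}
        \<le> (\<Sum>k = 1..s n. real n ^ (k - 1) * (fact (s n) / fact (s n - k)) *
              (c * ln (real n) / (real (s n) * real n)) ^ k)"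
      unfolding M_def using assms(1,3) elim(5) L
      by (intro prob_rainbow_connected_le) (auto simp: L_def)
    also have "\<dots> \<le> exp (2 + ln (real (s n)) / 2 + real (s n) * D n) / real n"
      unfolding D_def using assms(1) elim(4,5) s1 s_le' L
      by (intro first_moment_le) (auto simp: L_def)
    also have "\<dots> = exp (2 + ln (real (s n)) / 2 + real (s n) * D n - L)"
      using elim(5) by (simp add: L_def exp_diff)
    also have "\<dots> \<le> b n"
    proof -
      have "ln (real (s n)) \<le> ln (L / D n)"
        using s1 s_le' by (intro ln_mono) auto
      also have "\<dots> = ln L - ln (D n)" using L elim(2) by (simp add: ln_div)
      finally have 1: "ln (real (s n)) / 2 \<le> (ln L - ln (D n)) / 2" by simp
      have "real (s n) * D n \<le> (L / D n - 1 / 2 + t n) * D n"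
        using s_le elim(2) by (intro mult_right_mono) auto
      also have "\<dots> = L + (t n - 1 / 2) * D n"
        using elim(2) by (simp add: field_simps)
      finally have "real (s n) * D n \<le> L + (t n - 1 / 2) * D n" .
      with 1 show ?thesis
        unfolding b_def L_def exp_le_cancel_iff by linarith
    qed
    finally show ?case .
  qed
  have "(\<lambda>n. measure_pmf.prob (M n) {G. rainbow_connected (X n) (s n) G}) \<longlonglongrightarrow> 0"
    by (rule tendsto_sandwich[OF _ bound tendsto_const b_lim]) simp
  then have "(\<lambda>n. 1 - measure_pmf.prob (M n) {G. rainbow_connected (X n) (s n) G}) \<longlonglongrightarrow> 1 - 0"
    by (intro tendsto_intros)
  moreover have "1 - measure_pmf.prob (M n) {G. rainbow_connected (X n) (s n) G}
      = measure_pmf.prob (M n) {G. \<not> rainbow_connected (X n) (s n) G}" for n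
    using measure_pmf.prob_compl[of "{G. rainbow_connected (X n) (s n) G}" "M n"]
    by (simp add: Compl_eq_Diff_UNIV[symmetric] Collect_neg_eq)
  ultimately show ?thesis unfolding M_def by simp
qed

end
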